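(* Let $V$ be a finite-dimensional $\mathbb{Q}$-vector space with a non-degenerate symmetric bilinear pairing $(\cdot,\cdot):V\times V\to\mathbb{Q}$, decomposing as an orthogonal direct sum $V=U\oplus W$, and let $\Lambda\subseteq V$ be a full-rank lattice. Then $\mathcal{T}_{U,W}(\Lambda)\cong\mathcal{T}_{U,W}(\Lambda^\vee)$. If moreover $F=1+D$ is an automorphism of $\Lambda$ preserving $(\cdot,\cdot)$ and satisfying $V[D]=V[D^2]$, then $\mathcal{T}_D(\Lambda)\cong\mathcal{T}_D(\Lambda^\vee)$.
   Context: $\Lambda^\vee=\{v\in V:(v,\lambda)\in\mathbb{Z}\ \forall\lambda\in\Lambda\}$. $\mathcal{T}_{U,W}(\Lambda)=\Lambda/\big((\Lambda\cap U)+(\Lambda\cap W)\big)$. For $D$ with $V[D]=V[D^2]$ (where $V[D]=\ker D$), $V=DV\oplus V[D]$ and $\mathcal{T}_D(\Lambda)=\mathcal{T}_{DV,V[D]}(\Lambda)$. *)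

theory Defs
  imports "HOL-Algebra.Coset" Complex_Main
begin

definition bilinear_form :: "(rat \<Rightarrow> 'v \<Rightarrow> 'v) \<Rightarrow> ('v::ab_group_add \<Rightarrow> 'v \<Rightarrow> rat) \<Rightarrow> bool" where
  "bilinear_form scale B \<longleftrightarrow>
     (\<forall>x. Vector_Spaces.linear scale (*) (\<lambda>y. B x y)) \<and>
     (\<forall>y. Vector_Spaces.linear scale (*) (\<lambda>x. B x y))"

definition symmetric_form :: "('v \<Rightarrow> 'v \<Rightarrow> rat) \<Rightarrow> bool" where
  "symmetric_form B \<longleftrightarrow> (\<forall>x y. B x y = B y x)"

text \<open>One-sided; for symmetric forms (the only use) the two sides agree.\<close>

definition nondegenerate_form :: "('v::zero \<Rightarrow> 'v \<Rightarrow> rat) \<Rightarrow> bool" where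
  "nondegenerate_form B \<longleftrightarrow> (\<forall>x. (\<forall>y. B x y = 0) \<longrightarrow> x = 0)"

text \<open>The ambient space \<open>V\<close> is the whole type \<open>'v\<close>.\<close>

definition orthogonal_direct_sum ::
    "(rat \<Rightarrow> 'v \<Rightarrow> 'v) \<Rightarrow> ('v::ab_group_add \<Rightarrow> 'v \<Rightarrow> rat) \<Rightarrow> 'v set \<Rightarrow> 'v set \<Rightarrow> bool" where
  "orthogonal_direct_sum scale B U W \<longleftrightarrow>
     module.subspace scale U \<and> module.subspace scale W \<and>
     U \<inter> W = {0} \<and> {u + w | u w. u \<in> U \<and> w \<in> W} = UNIV \<and>
     (\<forall>u\<in>U. \<forall>w\<in>W. B u w = 0)"

text \<open>A full-rank lattice is the \<open>\<int>\<close>-span of a \<open>\<rat>\<close>-basis of \<open>V\<close>.\<close>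

definition full_rank_lattice :: "(rat \<Rightarrow> 'v \<Rightarrow> 'v) \<Rightarrow> 'v::ab_group_add set \<Rightarrow> bool" where
  "full_rank_lattice scale L \<longleftrightarrow>
     (\<exists>b. finite b \<and> \<not> module.dependent scale b \<and> module.span scale b = UNIV \<and>
          L = {\<Sum>v\<in>b. scale (of_int (c v)) v | c :: 'v \<Rightarrow> int. True})"

definition dual_lattice :: "('v \<Rightarrow> 'v \<Rightarrow> rat) \<Rightarrow> 'v set \<Rightarrow> 'v set" where
  "dual_lattice B L = {v. \<forall>l\<in>L. B v l \<in> \<int>}"

definition additive_group :: "'v::ab_group_add set \<Rightarrow> 'v monoid" where
  "additive_group L = \<lparr>carrier = L, monoid.mult = (+), one = 0\<rparr>"

definition TUW :: "'v::ab_group_add set \<Rightarrow> 'v set \<Rightarrow> 'v set \<Rightarrow> 'v set monoid" where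
  "TUW U W L = additive_group L Mod {x + y | x y. x \<in> L \<inter> U \<and> y \<in> L \<inter> W}"

definition ker_of :: "('v::zero \<Rightarrow> 'v) \<Rightarrow> 'v set" where
  "ker_of D = {v. D v = 0}"

definition TD :: "('v::ab_group_add \<Rightarrow> 'v) \<Rightarrow> 'v set \<Rightarrow> 'v set monoid" where
  "TD D L = TUW (range D) (ker_of D) L"

end

theory Submission imports Defs begin

text \<open>Let \<open>P\<close> be the orthogonal projection of \<open>V\<close> onto \<open>U\<close>. Under the pairing \<open>b x y = (P x, y)\<close>
  between \<open>\<Lambda>\<close> and \<open>\<Lambda>\<^sup>\<or>\<close>, an \<open>x \<in> \<Lambda>\<close> pairs integrally with all of \<open>\<Lambda>\<^sup>\<or>\<close> exactly when \<open>P x \<in> \<Lambda>\<close>, that is, when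
  \<open>x \<in> (\<Lambda> \<inter> U) + (\<Lambda> \<inter> W)\<close>, and symmetrically on the other side. So \<open>b\<close> induces a perfect pairing
  of the finite groups \<open>\<T>\<^bsub>U,W\<^esub>(\<Lambda>)\<close> and \<open>\<T>\<^bsub>U,W\<^esub>(\<Lambda>\<^sup>\<or>)\<close> into \<open>\<rat>/\<int>\<close>, and groups in perfect pairing are
  isomorphic. For the second claim, invariance of the form under \<open>1 + D\<close> makes \<open>DV\<close> and
  \<open>V[D]\<close> orthogonal.\<close>

section \<open>Fractions and linear maps over the rationals\<close>

text \<open>Write \<open>n * r\<close> in lowest terms as p/q. Non-integrality means q > 1, and a
  Bezout relation between p and q shows that 1/(n q) is an integer combination of 1/n and
  \<open>r\<close>. This is the device that contradicts the maximality of a denominator.\<close>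

lemma bezout_unit_fraction:
  fixes r :: rat and n :: int
  assumes "n > 0" and "of_int n * r \<notin> \<int>"
  obtains m s t where "m > n" "of_int s / of_int n + of_int t * r = 1 / of_int m"
proof -
  obtain p q where pq: "quotient_of (of_int n * r) = (p, q)" by fastforce
  then have q: "q > 0" "coprime p q" and nr: "of_int n * r = of_int p / of_int q"
    by (auto dest: quotient_of_denom_pos quotient_of_coprime quotient_of_div)
  then have r: "r = of_int p / (of_int q * of_int n)" using assms(1) by (simp add: field_simps)
  have "q \<noteq> 1" using nr assms(2) by auto
  then have "q > 1" using q by simp
  obtain u v where "u * p + v * q = 1"
    using bezout_int[of p q] q(2) by (auto simp: coprime_iff_gcd_eq_1)
  then have "of_int u * of_int p + of_int v * of_int q = (1::rat)"
    by (metis of_int_1 of_int_add of_int_mult)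
  moreover have "of_int v / of_int n + of_int u * r
      = (of_int u * of_int p + of_int v * of_int q) / of_int (n * q)"
    using q assms(1) by (simp add: r field_simps)
  ultimately have "of_int v / of_int n + of_int u * r = 1 / of_int (n * q)" by simp
  moreover have "n * q > n" using \<open>q > 1\<close> assms(1) by simp
  ultimately show thesis using that by blast
qed

lemma (in vector_space) linear_add_scale:
  assumes "Vector_Spaces.linear scale s f"
  shows "f (x + y) = f x + f y" "f (x - y) = f x - f y" "f 0 = 0" "f (c *s x) = s c (f x)"
    "f (sum g A) = (\<Sum>a\<in>A. f (g a))"
proof -
  interpret Vector_Spaces.linear scale s f by fact
  show "f (x + y) = f x + f y" "f (x - y) = f x - f y" "f 0 = 0" "f (c *s x) = s c (f x)"
    "f (sum g A) = (\<Sum>a\<in>A. f (g a))"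
    by (auto simp: add diff scale sum)
qed

section \<open>Pairings of additive subgroups modulo the integers\<close>

locale rat_space = vector_space scale for scale :: "rat \<Rightarrow> 'v::ab_group_add \<Rightarrow> 'v"
begin

text \<open>With integer scalars, \<open>int.subspace\<close> expresses that a set is an additive
  subgroup of the space, so lattices and kernels inherit the closure rules of submodules.\<close>

sublocale int: module "\<lambda>k::int. scale (of_int k)"
  by unfold_locales (auto simp: scale_right_distrib scale_left_distrib)

lemma bilinear_form_simps:
  assumes "bilinear_form scale B"
  shows "B (x + y) z = B x z + B y z" "B z (x + y) = B z x + B z y"
    "B (x - y) z = B x z - B y z" "B z (x - y) = B z x - B z y"
    "B (scale c x) z = c * B x z" "B z (scale c x) = c * B z x"
    "B 0 z = 0" "B z 0 = 0"
    "B (sum f A) z = (\<Sum>a\<in>A. B (f a) z)" "B z (sum f A) = (\<Sum>a\<in>A. B z (f a))"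
proof -
  have r: "Vector_Spaces.linear scale (*) (B z)"
    and l: "Vector_Spaces.linear scale (*) (\<lambda>x. B x z)" for z
    using assms unfolding bilinear_form_def by auto
  note lin = linear_add_scale[OF l] linear_add_scale[OF r]
  show "B (x + y) z = B x z + B y z" "B z (x + y) = B z x + B z y"
    "B (x - y) z = B x z - B y z" "B z (x - y) = B z x - B z y"
    "B (scale c x) z = c * B x z" "B z (scale c x) = c * B z x"
    "B 0 z = 0" "B z 0 = 0"
    "B (sum f A) z = (\<Sum>a\<in>A. B (f a) z)" "B z (sum f A) = (\<Sum>a\<in>A. B z (f a))"
    by (simp_all only: lin)
qed

text \<open>The relation \<open>R\<close> is the graph of an isomorphism between the quotients of \<open>M\<close> and \<open>N\<close>
  by the two kernels of the pairing modulo \<open>\<int>\<close>. In the induction, a pair \<open>(a, c)\<close> whose value has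
  maximal denominator splits off a cyclic summand of the same order on both sides. The function
  \<open>\<phi>\<close> only serves to express that the quotient of \<open>M\<close> is finite.\<close>

lemma pairing_mod_int_correspondence:
  fixes b :: "'v \<Rightarrow> 'v \<Rightarrow> rat" and \<phi> :: "'v \<Rightarrow> 'k" and d :: int
  assumes b: "bilinear_form scale b"
    and d: "d > 0"
    and "int.subspace M" "int.subspace N"
    and "\<And>x y. x \<in> M \<Longrightarrow> y \<in> N \<Longrightarrow> of_int d * b x y \<in> \<int>"
    and "finite (\<phi> ` M)"
    and "\<And>x x' y. x \<in> M \<Longrightarrow> x' \<in> M \<Longrightarrow> y \<in> N \<Longrightarrow> \<phi> x = \<phi> x' \<Longrightarrow> b (x - x') y \<in> \<int>"
  shows "\<exists>R. R \<subseteq> M \<times> N \<and> fst ` R = M \<and> snd ` R = N \<and>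
    (\<forall>x y x' y'. (x, y) \<in> R \<longrightarrow> (x', y') \<in> R \<longrightarrow> (x + x', y + y') \<in> R) \<and>
    (\<forall>x y. (x, y) \<in> R \<longrightarrow> (\<forall>z\<in>N. b x z \<in> \<int>) \<longleftrightarrow> (\<forall>z\<in>M. b z y \<in> \<int>))"
  using assms(3-)
proof (induction "card (\<phi> ` M)" arbitrary: M N rule: less_induct)
  case less
  note M = less.prems(1) and N = less.prems(2) and fin = less.prems(4) and \<phi> = less.prems(5)
  note bs = bilinear_form_simps[OF b]
  \<comment> \<open>\<open>P n\<close> says that 1/n occurs among the values of the pairing modulo
    \<open>\<int>\<close>. Any such \<open>n\<close> divides \<open>d\<close>, so a largest one
    exists.\<close>
  define P where "P n \<longleftrightarrow> n > 0 \<and> (\<exists>a\<in>M. \<exists>c\<in>N. b a c - 1 / of_int n \<in> \<int>)" for n :: int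
  have bound: "n \<le> d" if "P n" for n
  proof -
    from that obtain a c z where n: "n > 0" and ac: "a \<in> M" "c \<in> N"
      and z: "b a c - 1 / of_int n = of_int z"
      by (auto simp: P_def elim: Ints_cases)
    obtain w where "of_int d * b a c = of_int w"
      using less.prems(3)[OF ac] by (auto elim: Ints_cases)
    moreover have "b a c = of_int z + 1 / of_int n" using z by simp
    ultimately have "of_int d = (of_int n * (of_int w - of_int d * of_int z) :: rat)"
      using n by (simp add: field_simps)
    then have "d = n * (w - d * z)"
      by (metis of_int_diff of_int_eq_iff of_int_mult)
    then show ?thesis using d by (metis dvd_triv_left zdvd_imp_le)
  qed
  have "P 1" using int.subspace_0[OF M] int.subspace_0[OF N] by (force simp: P_def bs)
  then obtain n where n: "P n" and nmax: "\<And>m. P m \<Longrightarrow> m \<le> n"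
  proof -
    have "P n \<Longrightarrow> 0 \<le> n" for n by (simp add: P_def)
    then have "{n. P n} \<subseteq> {0..d}" using bound by auto
    then have "finite {n. P n}" by (rule finite_subset) simp
    then show thesis using that[of "Max {n. P n}"] \<open>P 1\<close> Max_in[of "{n. P n}"] Max_ge[of "{n. P n}"]
      by blast
  qed
  then obtain a c z where n0: "n > 0" and a: "a \<in> M" and c: "c \<in> N"
    and z: "b a c = 1 / of_int n + of_int z"
    by (auto simp: P_def diff_eq_eq add.commute elim!: Ints_cases)
  \<comment> \<open>The values of \<open>b a\<close> at \<open>c\<close> and at \<open>y\<close>
    would otherwise combine, by Bezout, to 1/m modulo \<open>\<int>\<close> with m > n, against the
    choice of \<open>n\<close>.\<close>
  have na: "of_int n * b a y \<in> \<int>" if y: "y \<in> N" for y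
  proof (rule ccontr)
    assume "of_int n * b a y \<notin> \<int>"
    then obtain m s t where m: "m > n" "of_int s / of_int n + of_int t * b a y = 1 / of_int m"
      by (rule bezout_unit_fraction[OF n0])
    have "b a (scale (of_int s) c + scale (of_int t) y) - 1 / of_int m = of_int (s * z)"
      by (simp add: bs z flip: m(2)) (simp add: algebra_simps)
    moreover have "scale (of_int s) c + scale (of_int t) y \<in> N"
      by (intro int.subspace_add int.subspace_scale N c y)
    ultimately have "P m" using a m n0 unfolding P_def
      by (metis Ints_of_int order_less_trans)
    then show False using nmax m by fastforce
  qed
  have nc: "of_int n * b x c \<in> \<int>" if x: "x \<in> M" for x
  proof (rule ccontr)
    assume "of_int n * b x c \<notin> \<int>"
    then obtain m s t where m: "m > n" "of_int s / of_int n + of_int t * b x c = 1 / of_int m"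
      by (rule bezout_unit_fraction[OF n0])
    have "b (scale (of_int s) a + scale (of_int t) x) c - 1 / of_int m = of_int (s * z)"
      by (simp add: bs z flip: m(2)) (simp add: algebra_simps)
    moreover have "scale (of_int s) a + scale (of_int t) x \<in> M"
      by (intro int.subspace_add int.subspace_scale M a x)
    ultimately have "P m" using c m n0 unfolding P_def
      by (metis Ints_of_int order_less_trans)
    then show False using nmax m by fastforce
  qed
  show ?case
  proof (cases "n = 1")
    case True
    \<comment> \<open>A non-integral value would produce some \<open>P m\<close> with m > 1. Hence
      the pairing is integral, both kernels are everything, and the full relation
      \<open>M \<times> N\<close> serves.\<close>
    have int: "b x y \<in> \<int>" if xy: "x \<in> M" "y \<in> N" for x y
    proof (rule ccontr)
      assume "b x y \<notin> \<int>"
      then obtain m s t where m: "m > 1" "of_int s / of_int 1 + of_int t * b x y = 1 / of_int m"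
        using bezout_unit_fraction[of 1 "b x y"] by auto
      have "b (scale (of_int t) x) y - 1 / of_int m = of_int (- s)"
        by (simp add: bs flip: m(2))
      moreover have "scale (of_int t) x \<in> M" by (intro int.subspace_scale M xy)
      ultimately have "P m" using xy(2) m unfolding P_def
        by (metis Ints_of_int zero_less_one order_less_trans)
      then show False using nmax m True by fastforce
    qed
    show ?thesis
      using int int.subspace_0[OF M] int.subspace_0[OF N]
      by (intro exI[of _ "M \<times> N"])
        (auto simp: int.subspace_add[OF M] int.subspace_add[OF N])
  next
    case False
    \<comment> \<open>\<open>M1\<close> and \<open>N1\<close> are the orthogonal complements of
      \<open>c\<close> and \<open>a\<close> modulo \<open>\<int>\<close>; the induction hypothesis
      is applied to them.\<close>
    define M1 where "M1 = {x \<in> M. b x c \<in> \<int>}"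
    define N1 where "N1 = {y \<in> N. b a y \<in> \<int>}"
    have M1: "int.subspace M1" and N1: "int.subspace N1"
      using M N by (auto simp: M1_def N1_def int.subspace_def bs)
    have "a \<notin> M1"
    proof
      assume "a \<in> M1"
      then obtain w where "b a c = of_int w" by (auto simp: M1_def elim: Ints_cases)
      then have "1 / of_int n + of_int z = (of_int w :: rat)" using z by simp
      then have "1 = (of_int n * (of_int w - of_int z) :: rat)" using n0
        by (simp add: field_simps)
      then have "1 = n * (w - z)"
        by (metis of_int_1 of_int_diff of_int_eq_iff of_int_mult)
      then show False using n0 False by (metis dvd_triv_left zdvd1_eq abs_of_pos)
    qed
    \<comment> \<open>A label shared with some \<open>x\<close> in \<open>M1\<close> would make
      \<open>b (a - x) c\<close>, and hence \<open>b a c\<close>, integral. This gives the strict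
      decrease of the induction measure.\<close>
    have "\<phi> a \<notin> \<phi> ` M1"
    proof
      assume "\<phi> a \<in> \<phi> ` M1"
      then obtain x where x: "x \<in> M1" "\<phi> a = \<phi> x" by auto
      then have "b (a - x) c + b x c \<in> \<int>" using \<phi>[of a x c] a c by (auto simp: M1_def)
      then show False using \<open>a \<notin> M1\<close> a by (simp add: bs M1_def)
    qed
    then have lt: "card (\<phi> ` M1) < card (\<phi> ` M)"
      using a by (intro psubset_card_mono fin) (auto simp: M1_def)
    have "\<exists>R. R \<subseteq> M1 \<times> N1 \<and> fst ` R = M1 \<and> snd ` R = N1 \<and>
      (\<forall>x y x' y'. (x, y) \<in> R \<longrightarrow> (x', y') \<in> R \<longrightarrow> (x + x', y + y') \<in> R) \<and>
      (\<forall>x y. (x, y) \<in> R \<longrightarrow> (\<forall>z\<in>N1. b x z \<in> \<int>) \<longleftrightarrow> (\<forall>z\<in>M1. b z y \<in> \<int>))"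
      using less.prems(3) \<phi>
      by (intro less.hyps lt M1 N1) (auto simp: M1_def N1_def intro: finite_subset[OF _ fin])
    then obtain R where R: "R \<subseteq> M1 \<times> N1" "fst ` R = M1" "snd ` R = N1"
      and "\<forall>x y x' y'. (x, y) \<in> R \<longrightarrow> (x', y') \<in> R \<longrightarrow> (x + x', y + y') \<in> R"
      and "\<forall>x y. (x, y) \<in> R \<longrightarrow> (\<forall>z\<in>N1. b x z \<in> \<int>) \<longleftrightarrow> (\<forall>z\<in>M1. b z y \<in> \<int>)"
      by (elim exE conjE) (rule that)
    note R_add = this(4)[rule_format] and R_ker = this(5)[rule_format]
    \<comment> \<open>As \<open>b a c\<close> is 1/n modulo \<open>\<int>\<close>, the integer
      \<open>n * b x c\<close> is the multiple of \<open>a\<close> to subtract.\<close>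
    have split_M: "\<exists>k. x - scale (of_int k) a \<in> M1" if x: "x \<in> M" for x
    proof -
      obtain k where "of_int n * b x c = of_int k" using nc[OF x] by (auto elim: Ints_cases)
      then have "b (x - scale (of_int k) a) c = of_int (- k * z)"
        using n0 by (simp add: bs z field_simps)
      then have "b (x - scale (of_int k) a) c \<in> \<int>" by (metis Ints_of_int)
      then show ?thesis
        unfolding M1_def using int.subspace_diff[OF M x int.subspace_scale[OF M a]] by blast
    qed
    have split_N: "\<exists>k. y - scale (of_int k) c \<in> N1" if y: "y \<in> N" for y
    proof -
      obtain k where "of_int n * b a y = of_int k" using na[OF y] by (auto elim: Ints_cases)
      then have "b a (y - scale (of_int k) c) = of_int (- k * z)"
        using n0 by (simp add: bs z field_simps)
      then have "b a (y - scale (of_int k) c) \<in> \<int>" by (metis Ints_of_int)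
      then show ?thesis
        unfolding N1_def using int.subspace_diff[OF N y int.subspace_scale[OF N c]] by blast
    qed
    have ker_a: "b (scale (of_int k) a) y \<in> \<int>" if "n dvd k" "y \<in> N" for k y
      using na[OF that(2)] that(1) by (auto simp: bs dvd_def mult_ac intro: Ints_mult)
    have ker_c: "b x (scale (of_int k) c) \<in> \<int>" if "n dvd k" "x \<in> M" for k x
      using nc[OF that(2)] that(1) by (auto simp: bs dvd_def mult_ac intro: Ints_mult)
    have dvd: "n dvd k" if "of_int k * b a c \<in> \<int>" for k
    proof -
      obtain w where "of_int k * b a c = of_int w" using \<open>of_int k * b a c \<in> \<int>\<close>
        by (auto elim: Ints_cases)
      then have "of_int k = (of_int n * (of_int w - of_int k * of_int z) :: rat)"
        using n0 by (simp add: z field_simps)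
      then have "k = n * (w - k * z)"
        by (metis of_int_diff of_int_eq_iff of_int_mult)
      then show ?thesis by (metis dvd_triv_left)
    qed
    \<comment> \<open>The summands decouple. Since \<open>x\<close> pairs integrally with
      \<open>c\<close>, the value at \<open>c\<close> tests only whether \<open>n\<close> divides
      \<open>k\<close>; and since every element of \<open>N\<close> lies in \<open>N1\<close> up to
      a multiple of \<open>c\<close>, testing \<open>x\<close> on \<open>N1\<close> is
      enough.\<close>
    have ker_M1: "(\<forall>z\<in>N. b (x + scale (of_int k) a) z \<in> \<int>) \<longleftrightarrow> n dvd k \<and> (\<forall>z\<in>N1. b x z \<in> \<int>)"
      if x: "x \<in> M1" for x k
    proof
      assume *: "\<forall>z\<in>N. b (x + scale (of_int k) a) z \<in> \<int>"
      have "b (x + scale (of_int k) a) c - b x c \<in> \<int>"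
        using * c x by (auto simp: M1_def)
      then have k: "n dvd k" by (intro dvd) (simp add: bs)
      moreover have "b x y \<in> \<int>" if y: "y \<in> N" for y
      proof -
        have "b (x + scale (of_int k) a) y - b (scale (of_int k) a) y \<in> \<int>"
          using * y ker_a[OF k y] by (intro Ints_diff) auto
        then show ?thesis by (simp add: bs)
      qed
      ultimately show "n dvd k \<and> (\<forall>z\<in>N1. b x z \<in> \<int>)" by (simp add: N1_def)
    next
      assume *: "n dvd k \<and> (\<forall>z\<in>N1. b x z \<in> \<int>)"
      show "\<forall>z\<in>N. b (x + scale (of_int k) a) z \<in> \<int>"
      proof
        fix y assume y: "y \<in> N"
        obtain l where "y - scale (of_int l) c \<in> N1" using split_N[OF y] by blast
        then have "b x (y - scale (of_int l) c) \<in> \<int>" using * by blast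
        moreover have "of_int l * b x c \<in> \<int>" using x by (auto simp: M1_def)
        ultimately have "b x (y - scale (of_int l) c) + of_int l * b x c \<in> \<int>" by (rule Ints_add)
        then have "b x y \<in> \<int>" by (simp add: bs)
        then show "b (x + scale (of_int k) a) y \<in> \<int>"
          using ker_a[of k y] * y by (simp add: bs)
      qed
    qed
    have ker_N1: "(\<forall>z\<in>M. b z (y + scale (of_int k) c) \<in> \<int>) \<longleftrightarrow> n dvd k \<and> (\<forall>z\<in>M1. b z y \<in> \<int>)"
      if y: "y \<in> N1" for y k
    proof
      assume *: "\<forall>z\<in>M. b z (y + scale (of_int k) c) \<in> \<int>"
      have "b a (y + scale (of_int k) c) - b a y \<in> \<int>"
        using * a y by (auto simp: N1_def)
      then have k: "n dvd k" by (intro dvd) (simp add: bs)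
      moreover have "b x y \<in> \<int>" if x: "x \<in> M" for x
      proof -
        have "b x (y + scale (of_int k) c) - b x (scale (of_int k) c) \<in> \<int>"
          using * x ker_c[OF k x] by (intro Ints_diff) auto
        then show ?thesis by (simp add: bs)
      qed
      ultimately show "n dvd k \<and> (\<forall>z\<in>M1. b z y \<in> \<int>)" by (simp add: M1_def)
    next
      assume *: "n dvd k \<and> (\<forall>z\<in>M1. b z y \<in> \<int>)"
      show "\<forall>z\<in>M. b z (y + scale (of_int k) c) \<in> \<int>"
      proof
        fix x assume x: "x \<in> M"
        obtain l where "x - scale (of_int l) a \<in> M1" using split_M[OF x] by blast
        then have "b (x - scale (of_int l) a) y \<in> \<int>" using * by blast
        moreover have "of_int l * b a y \<in> \<int>" using y by (auto simp: N1_def)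
        ultimately have "b (x - scale (of_int l) a) y + of_int l * b a y \<in> \<int>" by (rule Ints_add)
        then have "b x y \<in> \<int>" by (simp add: bs)
        then show "b x (y + scale (of_int k) c) \<in> \<int>"
          using ker_c[of k x] * x by (simp add: bs)
      qed
    qed
    \<comment> \<open>Using the same \<open>k\<close> on both sides matches \<open>a\<close> with
      \<open>c\<close>. By \<open>ker_M1\<close> and \<open>ker_N1\<close> both kernel conditions
      then add the same requirement \<open>n dvd k\<close> to those for \<open>R\<close>.\<close>
    define R' where
      "R' = {(x + scale (of_int k) a, y + scale (of_int k) c) | x y k. (x, y) \<in> R}"
    have R'_sub: "R' \<subseteq> M \<times> N"
      using R(1) unfolding R'_def M1_def N1_def
      by (auto intro!: int.subspace_add[OF M] int.subspace_add[OF N]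
          int.subspace_scale[OF M] int.subspace_scale[OF N] a c)
    have R'_M: "M \<subseteq> fst ` R'"
    proof
      fix x assume "x \<in> M"
      then obtain k where "x - scale (of_int k) a \<in> fst ` R" using split_M R(2) by blast
      then obtain y where "(x - scale (of_int k) a, y) \<in> R" by force
      then have "(x - scale (of_int k) a + scale (of_int k) a, y + scale (of_int k) c) \<in> R'"
        unfolding R'_def by blast
      then show "x \<in> fst ` R'" by force
    qed
    have R'_N: "N \<subseteq> snd ` R'"
    proof
      fix y assume "y \<in> N"
      then obtain k where "y - scale (of_int k) c \<in> snd ` R" using split_N R(3) by blast
      then obtain x where "(x, y - scale (of_int k) c) \<in> R" by force
      then have "(x + scale (of_int k) a, y - scale (of_int k) c + scale (of_int k) c) \<in> R'"
        unfolding R'_def by blast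
      then show "y \<in> snd ` R'" by force
    qed
    have R'_add: "(x + x', y + y') \<in> R'" if xy: "(x, y) \<in> R'" "(x', y') \<in> R'" for x y x' y'
    proof -
      obtain x0 y0 k x1 y1 l where eqs: "x = x0 + scale (of_int k) a" "y = y0 + scale (of_int k) c"
        "x' = x1 + scale (of_int l) a" "y' = y1 + scale (of_int l) c" "(x0, y0) \<in> R" "(x1, y1) \<in> R"
        using xy unfolding R'_def by blast
      have "x + x' = (x0 + x1) + scale (of_int (k + l)) a" "y + y' = (y0 + y1) + scale (of_int (k + l)) c"
        by (simp_all add: eqs scale_left_distrib)
      then show ?thesis using R_add[OF eqs(5,6)] unfolding R'_def by blast
    qed
    have R'_ker: "(\<forall>z\<in>N. b x z \<in> \<int>) \<longleftrightarrow> (\<forall>z\<in>M. b z y \<in> \<int>)" if xy: "(x, y) \<in> R'" for x y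
    proof -
      obtain x0 y0 k where eqs: "x = x0 + scale (of_int k) a" "y = y0 + scale (of_int k) c"
        "(x0, y0) \<in> R"
        using xy unfolding R'_def by blast
      then have "x0 \<in> M1" "y0 \<in> N1" using R(1) by auto
      then show ?thesis using ker_M1 ker_N1 R_ker eqs by simp
    qed
    have "fst ` R' = M" "snd ` R' = N" using R'_sub R'_M R'_N by fastforce+
    then show ?thesis using R'_sub R'_add R'_ker by (intro exI[of _ R'] conjI) blast+
  qed
qed


section \<open>Quotient groups of additive subgroups\<close>

lemma additive_group_simps [simp]:
  "carrier (additive_group L) = L"
  "x \<otimes>\<^bsub>additive_group L\<^esub> y = x + y"
  "\<one>\<^bsub>additive_group L\<^esub> = 0"
  by (simp_all add: additive_group_def)

lemma comm_group_additive_group: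
  assumes "int.subspace M"
  shows "comm_group (additive_group M)"
proof (rule comm_groupI)
  fix x assume "x \<in> carrier (additive_group M)"
  then show "\<exists>y\<in>carrier (additive_group M). y \<otimes>\<^bsub>additive_group M\<^esub> x = \<one>\<^bsub>additive_group M\<^esub>"
    using int.subspace_neg[OF assms] by (intro bexI[of _ "- x"]) auto
qed (auto simp: int.subspace_0[OF assms] int.subspace_add[OF assms] add_ac)

lemma subgroup_additive_group:
  assumes M: "int.subspace M" and K: "int.subspace K" and "K \<subseteq> M"
  shows "subgroup K (additive_group M)"
proof -
  interpret comm_group "additive_group M" by (rule comm_group_additive_group[OF M])
  have "inv\<^bsub>additive_group M\<^esub> x = - x" if "x \<in> M" for x
    using that int.subspace_neg[OF M] by (intro inv_equality) auto
  then show ?thesis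
    using assms(3) int.subspace_0[OF K] int.subspace_add[OF K] int.subspace_neg[OF K]
    by (intro subgroupI) auto
qed

text \<open>The relation need not be single-valued. Any choice function \<open>f\<close> inside
  \<open>R\<close> is additive modulo \<open>J\<close>, and sending \<open>x\<close> to the coset of
  \<open>f x\<close> is a surjective homomorphism with kernel \<open>K\<close>, so the first
  isomorphism theorem applies.\<close>

lemma quotient_iso_of_correspondence:
  assumes M: "int.subspace M" and N: "int.subspace N"
    and K: "int.subspace K" "K \<subseteq> M" and J: "int.subspace J" "J \<subseteq> N"
    and R: "fst ` R = M" "snd ` R = N"
    and R_add: "\<And>x y x' y'. (x, y) \<in> R \<Longrightarrow> (x', y') \<in> R \<Longrightarrow> (x + x', y + y') \<in> R"
    and R_ker: "\<And>x y. (x, y) \<in> R \<Longrightarrow> x \<in> K \<longleftrightarrow> y \<in> J"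
  shows "additive_group M Mod K \<cong> additive_group N Mod J"
proof -
  let ?M = "additive_group M" and ?N = "additive_group N"
  interpret M: comm_group ?M by (rule comm_group_additive_group[OF M])
  interpret N: comm_group ?N by (rule comm_group_additive_group[OF N])
  have J_sub: "subgroup J ?N" by (rule subgroup_additive_group[OF N J])
  then interpret J: normal J ?N by (simp add: N.normal_iff_subgroup)
  have "\<exists>y. (x, y) \<in> R" if "x \<in> M" for x using that R(1) by force
  then obtain f where f: "\<And>x. x \<in> M \<Longrightarrow> (x, f x) \<in> R" by metis
  have fN: "f x \<in> N" if "x \<in> M" for x using f[OF that] R(2) by force
  \<comment> \<open>Adding the pair of \<open>- x\<close> and \<open>f (- x)\<close> to both given
    pairs turns the first component into 0, which lies in \<open>K\<close>; the second components
    therefore lie in \<open>J\<close>, and so does their difference \<open>y' - y\<close>.\<close>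
  have coset: "J #>\<^bsub>?N\<^esub> y = J #>\<^bsub>?N\<^esub> y'" if y: "(x, y) \<in> R" "(x, y') \<in> R" for x y y'
  proof -
    have x: "- x \<in> M" using y(1) R(1) int.subspace_neg[OF M] by force
    have "0 \<in> K" by (rule int.subspace_0[OF K(1)])
    then have "y + f (- x) \<in> J" "y' + f (- x) \<in> J"
      using R_add[OF y(1) f[OF x]] R_add[OF y(2) f[OF x]] R_ker[of 0] by auto
    then have "(y' + f (- x)) - (y + f (- x)) \<in> J" by (intro int.subspace_diff[OF J(1)])
    then have "y' - y \<in> J" by simp
    then have "y' \<in> J #>\<^bsub>?N\<^esub> y" by (force simp: r_coset_def)
    moreover have "y \<in> N" using y(1) R(2) by force
    ultimately show ?thesis by (intro N.repr_independence J_sub) auto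
  qed
  define h where "h x = J #>\<^bsub>?N\<^esub> f x" for x
  have "h \<in> hom ?M (?N Mod J)"
  proof (rule homI)
    fix x assume "x \<in> carrier ?M"
    then show "h x \<in> carrier (?N Mod J)" using fN by (auto simp: h_def FactGroup_def RCOSETS_def)
  next
    fix x y assume "x \<in> carrier ?M" "y \<in> carrier ?M"
    then have xy: "x \<in> M" "y \<in> M" by auto
    then have "(x + y, f (x + y)) \<in> R" by (intro f int.subspace_add[OF M])
    then show "h (x \<otimes>\<^bsub>?M\<^esub> y) = h x \<otimes>\<^bsub>?N Mod J\<^esub> h y"
      using coset[OF _ R_add[OF f[OF xy(1)] f[OF xy(2)]]] J.rcos_sum fN xy
      by (simp add: h_def FactGroup_def)
  qed
  then interpret h: group_hom ?M "?N Mod J" h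
    by (intro group_hom.intro group_hom_axioms.intro J.factorgroup_is_group M.is_group)
  have "h ` carrier ?M = carrier (?N Mod J)"
  proof
    show "carrier (?N Mod J) \<subseteq> h ` carrier ?M"
    proof
      fix C assume "C \<in> carrier (?N Mod J)"
      then obtain y where y: "y \<in> N" "C = J #>\<^bsub>?N\<^esub> y" by (auto simp: FactGroup_def RCOSETS_def)
      then obtain x where x: "(x, y) \<in> R" using R(2) by force
      then have "x \<in> M" using R(1) by force
      then show "C \<in> h ` carrier ?M" using coset[OF x f] y(2) by (auto simp: h_def)
    qed
  qed auto
  moreover have "kernel ?M (?N Mod J) h = K"
  proof -
    have "h x = J \<longleftrightarrow> x \<in> K" if x: "x \<in> M" for x
      using R_ker[OF f[OF x]] N.coset_join1[OF _ _ J_sub] N.coset_join2[OF _ J_sub] fN[OF x]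
      by (auto simp: h_def)
    then show ?thesis using K(2) by (auto simp: kernel_def FactGroup_def)
  qed
  ultimately show ?thesis using h.FactGroup_iso by simp
qed

text \<open>Dividing by the left and right kernels modulo \<open>\<int>\<close> leaves finite groups
  in perfect pairing. The isomorphism is not canonical: it comes from the choices made in building
  the correspondence.\<close>

lemma pairing_mod_int_quotients_iso:
  fixes b :: "'v \<Rightarrow> 'v \<Rightarrow> rat" and \<phi> :: "'v \<Rightarrow> 'k" and d :: int
  assumes b: "bilinear_form scale b"
    and d: "d > 0"
    and M: "int.subspace M" and N: "int.subspace N"
    and "\<And>x y. x \<in> M \<Longrightarrow> y \<in> N \<Longrightarrow> of_int d * b x y \<in> \<int>"
    and "finite (\<phi> ` M)"
    and "\<And>x x' y. x \<in> M \<Longrightarrow> x' \<in> M \<Longrightarrow> y \<in> N \<Longrightarrow> \<phi> x = \<phi> x' \<Longrightarrow> b (x - x') y \<in> \<int>"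
  shows "additive_group M Mod {x \<in> M. \<forall>z\<in>N. b x z \<in> \<int>}
    \<cong> additive_group N Mod {y \<in> N. \<forall>z\<in>M. b z y \<in> \<int>}"
proof -
  have "\<exists>R. R \<subseteq> M \<times> N \<and> fst ` R = M \<and> snd ` R = N \<and>
    (\<forall>x y x' y'. (x, y) \<in> R \<longrightarrow> (x', y') \<in> R \<longrightarrow> (x + x', y + y') \<in> R) \<and>
    (\<forall>x y. (x, y) \<in> R \<longrightarrow> (\<forall>z\<in>N. b x z \<in> \<int>) \<longleftrightarrow> (\<forall>z\<in>M. b z y \<in> \<int>))"
    by (rule pairing_mod_int_correspondence) (use assms in auto)
  then obtain R where R: "R \<subseteq> M \<times> N" "fst ` R = M" "snd ` R = N"
    and "\<forall>x y x' y'. (x, y) \<in> R \<longrightarrow> (x', y') \<in> R \<longrightarrow> (x + x', y + y') \<in> R"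
    and "\<forall>x y. (x, y) \<in> R \<longrightarrow> (\<forall>z\<in>N. b x z \<in> \<int>) \<longleftrightarrow> (\<forall>z\<in>M. b z y \<in> \<int>)"
    by (elim exE conjE) (rule that)
  note R_add = this(4)[rule_format] and R_ker = this(5)[rule_format]
  show ?thesis
  proof (rule quotient_iso_of_correspondence[OF M N _ _ _ _ R(2,3) R_add])
    show "int.subspace {x \<in> M. \<forall>z\<in>N. b x z \<in> \<int>}" "int.subspace {y \<in> N. \<forall>z\<in>M. b z y \<in> \<int>}"
      using M N by (auto simp: int.subspace_def bilinear_form_simps[OF b])
  next
    fix x y assume "(x, y) \<in> R"
    then show "x \<in> {x \<in> M. \<forall>z\<in>N. b x z \<in> \<int>} \<longleftrightarrow> y \<in> {y \<in> N. \<forall>z\<in>M. b z y \<in> \<int>}"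
      using R(1) R_ker by auto
  qed auto
qed

end

section \<open>Common denominators, dual bases and lattice coordinates\<close>

lemma common_denominator:
  fixes g :: "'a \<Rightarrow> rat"
  assumes "finite A"
  obtains d :: int where "d > 0" "\<And>a. a \<in> A \<Longrightarrow> of_int d * g a \<in> \<int>"
proof -
  have "\<exists>d::int. d > 0 \<and> (\<forall>a\<in>A. of_int d * g a \<in> \<int>)"
    using assms
  proof induction
    case empty
    then show ?case by (intro exI[of _ 1]) auto
  next
    case (insert a A)
    then obtain d :: int where d: "d > 0" "\<forall>a\<in>A. of_int d * g a \<in> \<int>" by blast
    obtain p q where pq: "quotient_of (g a) = (p, q)" by fastforce
    then have q: "q > 0" "g a = of_int p / of_int q"
      by (auto dest: quotient_of_denom_pos quotient_of_div)
    have "of_int (d * q) * g x \<in> \<int>" if "x \<in> insert a A" for x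
    proof (cases "x = a")
      case True
      have "of_int (d * q) * g x = of_int (d * p)" using q True by simp
      then show ?thesis by (metis Ints_of_int)
    next
      case False
      then have "of_int q * (of_int d * g x) \<in> \<int>" using d that by (auto intro!: Ints_mult[OF Ints_of_int])
      then show ?thesis by (simp add: mult_ac)
    qed
    then show ?case using d q by (intro exI[of _ "d * q"]) auto
  qed
  then show thesis using that by blast
qed

locale finite_dimensional_rat_space = finite_dimensional_vector_space scale Basis
  for scale :: "rat \<Rightarrow> 'v::ab_group_add \<Rightarrow> 'v" and Basis
begin

sublocale rat_space scale ..

text \<open>The map \<open>T\<close> records the values of \<open>B x\<close> on the basis
  \<open>e\<close> as coordinates. It is injective because the form is nondegenerate, hence
  surjective by finite dimension, and a right inverse of \<open>T\<close> gives the dual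
  vectors.\<close>

lemma dual_basis:
  assumes B: "bilinear_form scale B" and nd: "nondegenerate_form B"
    and e: "finite e" "independent e" "span e = UNIV"
  obtains f where "\<And>v w. v \<in> e \<Longrightarrow> w \<in> e \<Longrightarrow> B (f v) w = (if v = w then 1 else 0)"
proof -
  note Bs = bilinear_form_simps[OF B]
  define T where "T x = (\<Sum>w\<in>e. scale (B x w) w)" for x
  have lin: "Vector_Spaces.linear scale scale T"
    unfolding Vector_Spaces.linear_iff T_def
    by (auto simp: Bs scale_left_distrib sum.distrib scale_sum_right vector_space_axioms)
  have "inj T"
  proof (rule injI)
    fix x y assume "T x = T y"
    then have "(\<Sum>w\<in>e. scale (B (x - y) w) w) = 0"
      by (simp add: T_def Bs scale_left_diff_distrib sum_subtractf)
    then have 0: "B (x - y) w = 0" if "w \<in> e" for w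
      using independentD[OF e(2,1) order_refl _ that] by blast
    have "B (x - y) z = 0" for z
    proof -
      obtain u where "z = (\<Sum>v\<in>e. scale (u v) v)" using span_finite[OF e(1)] e(3) by auto
      then show ?thesis using 0 by (simp only: Bs(6,10)) simp
    qed
    then have "x - y = 0" using nd unfolding nondegenerate_form_def by blast
    then show "x = y" by simp
  qed
  then have "surj T" using lin linear_inj_imp_surj by blast
  then obtain f where f: "\<And>v. T (f v) = v" by (metis surjD)
  have "B (f v) w = (if v = w then 1 else 0)" if "v \<in> e" "w \<in> e" for v w
  proof -
    have "(\<Sum>w\<in>e. scale (if v = w then 1 else 0) w) = (\<Sum>w\<in>e. if v = w then w else 0)"
      by (intro sum.cong) auto
    also have "\<dots> = v" using e(1) that(1) by simp
    finally have "(\<Sum>w\<in>e. scale (B (f v) w - (if v = w then 1 else 0)) w) = 0"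
      using f[of v] by (simp add: T_def scale_left_diff_distrib sum_subtractf)
    then show ?thesis using independentD[OF e(2,1) order_refl _ that(2)] by fastforce
  qed
  then show thesis using that by blast
qed

text \<open>Pairing with the dual vectors reads off coordinates, so membership in the lattice
  becomes a finite list of integrality conditions.\<close>

lemma full_rank_lattice_coordinates:
  assumes B: "bilinear_form scale B" and nd: "nondegenerate_form B"
    and L: "full_rank_lattice scale L"
  obtains e f where "finite e" "\<And>x. x = (\<Sum>v\<in>e. scale (B (f v) x) v)"
    "L = {x. \<forall>v\<in>e. B (f v) x \<in> \<int>}"
proof -
  note Bs = bilinear_form_simps[OF B]
  obtain e where e: "finite e" "independent e" "span e = UNIV"
    and Le: "L = {\<Sum>v\<in>e. scale (of_int (c v)) v | c :: 'v \<Rightarrow> int. True}"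
    using L unfolding full_rank_lattice_def by blast
  obtain f where f: "\<And>v w. v \<in> e \<Longrightarrow> w \<in> e \<Longrightarrow> B (f v) w = (if v = w then 1 else 0)"
    using dual_basis[OF B nd e] by blast
  have coord: "B (f w) (\<Sum>v\<in>e. scale (u v) v) = u w" if "w \<in> e" for u w
  proof -
    have "B (f w) (\<Sum>v\<in>e. scale (u v) v) = (\<Sum>v\<in>e. if w = v then u v else 0)"
      unfolding Bs by (intro sum.cong) (auto simp: f that)
    then show ?thesis using e(1) that by simp
  qed
  have sum: "x = (\<Sum>v\<in>e. scale (B (f v) x) v)" for x
  proof -
    obtain u where "x = (\<Sum>v\<in>e. scale (u v) v)" using span_finite[OF e(1)] e(3) by auto
    then show ?thesis using coord by (simp cong: sum.cong)
  qed
  have "L = {x. \<forall>v\<in>e. B (f v) x \<in> \<int>}"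
  proof (intro Set.set_eqI iffI)
    fix x assume "x \<in> {x. \<forall>v\<in>e. B (f v) x \<in> \<int>}"
    \<comment> \<open>The floor changes nothing on integral coordinates and supplies the
      integer-valued coefficient function that the definition of a lattice asks for.\<close>
    then have "(\<Sum>v\<in>e. scale (B (f v) x) v) = (\<Sum>v\<in>e. scale (of_int \<lfloor>B (f v) x\<rfloor>) v)"
      by (intro sum.cong) (auto elim: Ints_cases)
    then have "x = (\<Sum>v\<in>e. scale (of_int \<lfloor>B (f v) x\<rfloor>) v)" by (rule trans[OF sum])
    then show "x \<in> L" unfolding Le mem_Collect_eq by (intro exI[of _ "\<lambda>v. \<lfloor>B (f v) x\<rfloor>"] conjI TrueI)
  qed (auto simp: Le coord)
  then show thesis using that e(1) sum by blast
qed

section \<open>The projection pairing between a lattice and its dual\<close>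

lemma int_subspace_dual_lattice:
  assumes "bilinear_form scale B"
  shows "int.subspace (dual_lattice B L)"
  by (auto simp: int.subspace_def dual_lattice_def bilinear_form_simps[OF assms])

lemma TUW_iso_dual:
  assumes B: "bilinear_form scale B" and sym: "symmetric_form B" and nd: "nondegenerate_form B"
    and UW: "orthogonal_direct_sum scale B U W" and L: "full_rank_lattice scale L"
  shows "TUW U W L \<cong> TUW U W (dual_lattice B L)"
proof -
  note Bs = bilinear_form_simps[OF B]
  have B_sym: "B x y = B y x" for x y using sym by (simp add: symmetric_form_def)
  obtain e f where e: "finite e" and sum: "\<And>x. x = (\<Sum>v\<in>e. scale (B (f v) x) v)"
    and Le: "L = {x. \<forall>v\<in>e. B (f v) x \<in> \<int>}"
    by (rule full_rank_lattice_coordinates[OF B nd L]) (rule that)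
  have U: "subspace U" and W: "subspace W" and UW0: "U \<inter> W = {0}"
    and sumUW: "{u + w | u w. u \<in> U \<and> w \<in> W} = UNIV"
    and orth: "\<And>u w. u \<in> U \<Longrightarrow> w \<in> W \<Longrightarrow> B u w = 0"
    using UW by (auto simp: orthogonal_direct_sum_def)
  have "\<exists>u. u \<in> U \<and> x - u \<in> W" for x
  proof -
    have "x \<in> {u + w | u w. u \<in> U \<and> w \<in> W}" using sumUW by simp
    then show ?thesis by force
  qed
  then obtain P where P: "\<And>x. P x \<in> U" "\<And>x. x - P x \<in> W" by metis
  \<comment> \<open>\<open>P\<close> was obtained by choice alone; uniqueness of the decomposition
    is what makes it linear.\<close>
  have P_eq: "P x = u" if u: "u \<in> U" "x - u \<in> W" for x u
  proof -
    have "P x - u \<in> U" by (intro subspace_diff U P u)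
    moreover have "(x - u) - (x - P x) \<in> W" by (intro subspace_diff W P u)
    ultimately have "P x - u \<in> U \<inter> W" by simp
    then show ?thesis using UW0 by simp
  qed
  have P_add: "P (x + y) = P x + P y" for x y
  proof (rule P_eq)
    have "(x - P x) + (y - P y) \<in> W" by (intro subspace_add W P)
    then show "x + y - (P x + P y) \<in> W" by (simp add: algebra_simps)
  qed (intro subspace_add U P)
  have P_scale: "P (scale k x) = scale k (P x)" for k x
  proof (rule P_eq)
    have "scale k (x - P x) \<in> W" by (intro subspace_scale W P)
    then show "scale k x - scale k (P x) \<in> W" by (simp add: scale_right_diff_distrib)
  qed (intro subspace_scale U P)
  have P_lin: "Vector_Spaces.linear scale scale P"
    by (simp add: Vector_Spaces.linear_iff P_add P_scale vector_space_axioms)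
  \<comment> \<open>By orthogonality of the summands both sides equal
    \<open>B (P x) (P y)\<close>.\<close>
  have P_adj: "B (P x) y = B (P y) x" for x y
  proof -
    have "B (P x) y = B (P x) (P y)" using orth[OF P(1) P(2), of x y] by (simp add: Bs)
    also have "\<dots> = B (P y) x" using orth[OF P(1) P(2), of y x] by (simp add: Bs B_sym)
    finally show ?thesis .
  qed
  define b where "b x y = B (P x) y" for x y
  have b_P: "b x y = B (P y) x" for x y unfolding b_def by (rule P_adj)
  have b: "bilinear_form scale b"
    unfolding bilinear_form_def
  proof (intro conjI allI)
    fix x
    show "Vector_Spaces.linear scale (*) (b x)"
      using B unfolding bilinear_form_def b_def by blast
    show "Vector_Spaces.linear scale (*) (\<lambda>y. b y x)"
      using Vector_Spaces.linear_compose[OF P_lin] B unfolding bilinear_form_def b_def comp_def by blast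
  qed
  let ?N = "dual_lattice B L"
  have N: "int.subspace ?N" by (rule int_subspace_dual_lattice[OF B])
  have LS: "int.subspace L" by (auto simp: Le int.subspace_def Bs)
  have N_L: "B x y \<in> \<int>" "B y x \<in> \<int>" if "x \<in> L" "y \<in> ?N" for x y
    using that B_sym[of x y] by (auto simp: dual_lattice_def)
  \<comment> \<open>The dual vectors \<open>f v\<close> belong to the dual lattice, and pairing with
    them already detects membership in \<open>L\<close>.\<close>
  have double_dual: "x \<in> L" if "\<And>y. y \<in> ?N \<Longrightarrow> B x y \<in> \<int>" for x
  proof -
    have "f v \<in> ?N" if "v \<in> e" for v using that by (simp add: dual_lattice_def Le)
    then show ?thesis using that B_sym[of x] by (simp add: Le)
  qed
  \<comment> \<open>\<open>d\<close> clears the denominators of the matrix of \<open>P\<close> in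
    the basis \<open>e\<close>, so that \<open>d\<close> times \<open>P\<close> maps
    \<open>L\<close> into itself.\<close>
  obtain d :: int where d: "d > 0" and "\<And>p. p \<in> e \<times> e \<Longrightarrow> of_int d * B (f (fst p)) (P (snd p)) \<in> \<int>"
    using common_denominator[of "e \<times> e" "\<lambda>p. B (f (fst p)) (P (snd p))"] e by blast
  then have d': "of_int d * B (f v) (P w) \<in> \<int>" if "v \<in> e" "w \<in> e" for v w
    using that by force
  have dP: "scale (of_int d) (P x) \<in> L" if x: "x \<in> L" for x
  proof -
    have "B (f v) (scale (of_int d) (P x)) \<in> \<int>" if v: "v \<in> e" for v
    proof -
      have "P x = (\<Sum>w\<in>e. scale (B (f w) x) (P w))"
        by (subst sum[of x]) (simp add: linear_add_scale(5)[OF P_lin] P_scale)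
      then have "B (f v) (scale (of_int d) (P x))
          = (\<Sum>w\<in>e. B (f w) x * (of_int d * B (f v) (P w)))"
        by (simp add: Bs sum_distrib_left mult_ac)
      also have "\<dots> \<in> \<int>" using x d'[OF v] by (auto simp: Le intro: Ints_mult[of "B _ x"])
      finally show ?thesis .
    qed
    then show ?thesis by (simp add: Le)
  qed
  \<comment> \<open>Coordinates modulo \<open>d\<close>: equal labels mean that the difference lies
    in \<open>d\<close> times \<open>L\<close>, which \<open>P\<close> maps into \<open>L\<close>.
    Restricting to \<open>e\<close> makes the set of labels finite.\<close>
  define \<phi> where "\<phi> x = restrict (\<lambda>v. \<lfloor>B (f v) x\<rfloor> mod d) e" for x
  have fin: "finite (\<phi> ` L)"
  proof (rule finite_subset)
    show "\<phi> ` L \<subseteq> e \<rightarrow>\<^sub>E {0..<d}" using d by (auto simp: \<phi>_def)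
    show "finite (e \<rightarrow>\<^sub>E {0..<d})" using e by (intro finite_PiE) auto
  qed
  have \<phi>: "b (x - x') y \<in> \<int>" if x: "x \<in> L" "x' \<in> L" and y: "y \<in> ?N" and eq: "\<phi> x = \<phi> x'" for x x' y
  proof -
    define z where "z = scale (1 / of_int d) (x - x')"
    have "B (f v) z \<in> \<int>" if v: "v \<in> e" for v
    proof -
      obtain k k' where k: "B (f v) x = of_int k" "B (f v) x' = of_int k'"
        using x v by (auto simp: Le elim!: Ints_cases dest!: bspec)
      have "k mod d = k' mod d" using fun_cong[OF eq, of v] v k by (simp add: \<phi>_def)
      then obtain l where "k - k' = d * l" by (metis mod_eq_dvd_iff dvdE)
      then have "of_int k - of_int k' = (of_int d * of_int l :: rat)"
        by (metis of_int_diff of_int_mult)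
      then have "B (f v) z = of_int l" using d by (simp add: z_def Bs k)
      then show ?thesis by simp
    qed
    then have "z \<in> L" by (simp add: Le)
    moreover have "x - x' = scale (of_int d) z" using d by (simp add: z_def)
    ultimately have "P (x - x') \<in> L" using dP[of z] by (simp add: P_scale)
    then show ?thesis using N_L y by (simp add: b_def)
  qed
  have db: "of_int d * b x y \<in> \<int>" if "x \<in> L" "y \<in> ?N" for x y
    using N_L(1)[OF dP[OF that(1)] that(2)] by (simp add: b_def Bs)
  \<comment> \<open>If \<open>x\<close> is a sum of elements of \<open>M \<inter> U\<close> and
    \<open>M \<inter> W\<close>, its first component must be \<open>P x\<close>; conversely
    \<open>P x\<close> and \<open>x - P x\<close> are such components once \<open>P x\<close> lies
    in \<open>M\<close>.\<close>
  have sums: "{x + y | x y. x \<in> M \<inter> U \<and> y \<in> M \<inter> W} = {x \<in> M. P x \<in> M}" (is "?S = ?T")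
    if M: "int.subspace M" for M
  proof
    have "P (x + y) = x" if "x \<in> U" "y \<in> W" for x y using that by (intro P_eq) auto
    then show "?S \<subseteq> ?T" by (auto intro: int.subspace_add[OF M])
    show "?T \<subseteq> ?S"
    proof
      fix x assume "x \<in> ?T"
      then have "P x \<in> M \<inter> U" "x - P x \<in> M \<inter> W" "x = P x + (x - P x)"
        using P int.subspace_diff[OF M] by auto
      then show "x \<in> ?S" by blast
    qed
  qed
  \<comment> \<open>The left kernel is identified by the double dual property. For the right kernel
    the definition of the dual lattice suffices, after \<open>b_P\<close> moves the projection to
    the other argument.\<close>
  have "P x \<in> L \<longleftrightarrow> (\<forall>z\<in>?N. b x z \<in> \<int>)" for x
  proof
    show "\<forall>z\<in>?N. b x z \<in> \<int>" if "P x \<in> L" using N_L(1)[OF that] by (simp add: b_def)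
    show "P x \<in> L" if "\<forall>z\<in>?N. b x z \<in> \<int>" using that by (intro double_dual) (simp add: b_def)
  qed
  then have "{x \<in> L. P x \<in> L} = {x \<in> L. \<forall>z\<in>?N. b x z \<in> \<int>}" by simp
  moreover have "{y \<in> ?N. P y \<in> ?N} = {y \<in> ?N. \<forall>z\<in>L. b z y \<in> \<int>}"
    unfolding b_P dual_lattice_def by blast
  ultimately have "additive_group L Mod {x \<in> L. P x \<in> L} \<cong> additive_group ?N Mod {y \<in> ?N. P y \<in> ?N}"
    by (simp only:) (intro pairing_mod_int_quotients_iso[OF b d LS N _ fin] db \<phi>)
  then show ?thesis by (simp only: TUW_def sums[OF LS] sums[OF N])
qed

section \<open>Orthogonal splitting into range and kernel\<close>

text \<open>A vector killed by \<open>D\<close> is fixed by 1 + D, so invariance of the form makes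
  it orthogonal to the range. The kernel condition makes \<open>D\<close> injective on its range,
  hence by dimension \<open>D\<close> maps its range onto itself, and this yields the
  decomposition.\<close>

lemma orthogonal_direct_sum_range_kernel:
  assumes B: "bilinear_form scale B" and nd: "nondegenerate_form B"
    and L: "full_rank_lattice scale L"
    and D: "Vector_Spaces.linear scale scale D"
    and iso: "\<And>x y. x \<in> L \<Longrightarrow> y \<in> L \<Longrightarrow> B (x + D x) (y + D y) = B x y"
    and ker: "ker_of D = ker_of (D \<circ> D)"
  shows "orthogonal_direct_sum scale B (range D) (ker_of D)"
proof -
  note Bs = bilinear_form_simps[OF B] and Ds = linear_add_scale[OF D]
  interpret D: Vector_Spaces.linear scale scale D by fact
  interpret pair: finite_dimensional_vector_space_pair_1 scale Basis scale ..
  obtain e :: "'v set" and f where e: "finite e" and Le: "L = {x. \<forall>v\<in>e. B (f v) x \<in> \<int>}"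
    by (rule full_rank_lattice_coordinates[OF B nd L]) (rule that)
  have multiple: "\<exists>d::int. d > 0 \<and> scale (of_int d) x \<in> L" for x
  proof -
    obtain d :: int where "d > 0" "\<And>v. v \<in> e \<Longrightarrow> of_int d * B (f v) x \<in> \<int>"
      by (rule common_denominator[OF e, of "\<lambda>v. B (f v) x"]) (rule that)
    then show ?thesis by (intro exI[of _ d]) (simp add: Le Bs)
  qed
  have orth: "B (D x) y = 0" if y: "D y = 0" for x y
  proof -
    \<comment> \<open>Invariance is given on \<open>L\<close> only, so both vectors are first scaled
      into the lattice; the nonzero factors cancel afterwards.\<close>
    obtain m :: int where m: "m > 0" "scale (of_int m) x \<in> L" using multiple[of x] by blast
    obtain n :: int where n: "n > 0" "scale (of_int n) y \<in> L" using multiple[of y] by blast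
    show ?thesis using iso[OF m(2) n(2)] m(1) n(1) y by (simp add: Ds Bs algebra_simps)
  qed
  have ker_D: "D x = 0" if "D (D x) = 0" for x using ker that by (auto simp: ker_of_def)
  have range: "subspace (range D)" by (intro D.subspace_image subspace_UNIV)
  have "inj_on D (range D)"
  proof (rule inj_onI)
    fix x y assume "x \<in> range D" "y \<in> range D" and eq: "D x = D y"
    then obtain u v where uv: "x = D u" "y = D v" by blast
    then have "D (D (u - v)) = 0" using eq by (simp add: Ds)
    then have "D (u - v) = 0" by (rule ker_D)
    then show "x = y" using uv by (simp add: Ds)
  qed
  then have "dim (D ` range D) = dim (range D)"
    by (intro pair.dim_image_eq[OF D]) (simp only: range span_eq_iff[THEN iffD2])
  then have DD: "D ` range D = range D"
    by (intro subspace_dim_equal D.subspace_image range) auto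
  have "x \<in> {u + w | u w. u \<in> range D \<and> w \<in> ker_of D}" for x
  proof -
    have "D x \<in> D ` range D" using DD by blast
    \<comment> \<open>\<open>D u\<close> is the range component of \<open>x\<close>: it has the same
      image under \<open>D\<close>, so the remainder lies in the kernel.\<close>
    then obtain u where u: "D x = D (D u)" by auto
    then have "x - D u \<in> ker_of D" by (simp add: ker_of_def Ds)
    moreover have "x = D u + (x - D u)" by simp
    ultimately show ?thesis by blast
  qed
  moreover have "range D \<inter> ker_of D = {0}"
    using ker_D Ds(3) by (auto simp: ker_of_def intro: range_eqI[of _ _ 0])
  moreover have "subspace (ker_of D)" unfolding ker_of_def by (rule D.subspace_kernel)
  ultimately show ?thesis
    using range orth by (auto simp: orthogonal_direct_sum_def ker_of_def)
qed

end

theorem theorem2p3p4: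
  fixes scale :: "rat \<Rightarrow> 'v::ab_group_add \<Rightarrow> 'v"
    and Basis :: "'v set"
    and B :: "'v \<Rightarrow> 'v \<Rightarrow> rat"
    and U W L :: "'v set"
  assumes "finite_dimensional_vector_space scale Basis"
    and "bilinear_form scale B"
    and "symmetric_form B"
    and "nondegenerate_form B"
    and "orthogonal_direct_sum scale B U W"
    and "full_rank_lattice scale L"
  shows "TUW U W L \<cong> TUW U W (dual_lattice B L) \<and>
    (\<forall>F D. Vector_Spaces.linear scale scale D \<longrightarrow>
       F = (\<lambda>v. v + D v) \<longrightarrow>
       F \<in> iso (additive_group L) (additive_group L) \<longrightarrow>
       (\<forall>x\<in>L. \<forall>y\<in>L. B (F x) (F y) = B x y) \<longrightarrow>
       ker_of D = ker_of (D \<circ> D) \<longrightarrow>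
       TD D L \<cong> TD D (dual_lattice B L))"
proof -
  interpret finite_dimensional_rat_space scale Basis
    using assms(1) by (simp add: finite_dimensional_rat_space_def)
  show ?thesis
  proof (intro conjI allI impI)
    show "TUW U W L \<cong> TUW U W (dual_lattice B L)" by (rule TUW_iso_dual[OF assms(2-6)])
  next
    fix F D
    assume D: "Vector_Spaces.linear scale scale D" and F: "F = (\<lambda>v. v + D v)"
      and pres: "\<forall>x\<in>L. \<forall>y\<in>L. B (F x) (F y) = B x y" and ker: "ker_of D = ker_of (D \<circ> D)"
    have "orthogonal_direct_sum scale B (range D) (ker_of D)"
      using orthogonal_direct_sum_range_kernel[OF assms(2,4,6) D _ ker] pres F by simp
    then show "TD D L \<cong> TD D (dual_lattice B L)"
      unfolding TD_def using TUW_iso_dual assms(2,3,4,6) by blast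
  qed
qed

end
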